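(* For every integer $n\ge 4$, $\gamma_2(n)\ge 2n$.
   Context: $\mathbb{N}$ denotes the positive integers. For a finite set $A$, $O_A$ is the set of all finitary operations $A^m\to A$ ($m\in\mathbb{N}$); for $F\subseteq O_A$, $F^{(m)}$ is the set of $m$-ary operations in $F$. A set $F\subseteq O_A$ is a clone on $A$ if it contains all projections and is closed under composition: for $f\in F^{(m)}$ and $g_1,\dots,g_m\in F^{(m')}$, the operation $f(g_1,\dots,g_m)(x_1,\dots,x_{m'}) := f(g_1(x_1,\dots,x_{m'}),\dots,g_m(x_1,\dots,x_{m'}))$ is in $F$. $\mathrm{Clo}(F)$ is the smallest clone containing $F$. For $d\ge 2$, an operation $g\colon A^{d+1}\to A$ is a near-unanimity operation if for all $x,y\in A$: $g(x,\dots,x,y)=g(x,\dots,x,y,x)=\dots=g(y,x,\dots,x)=x$. It is conservative if $g(x_1,\dots,x_{d+1})\in\{x_1,\dots,x_{d+1}\}$ for all $x_1,\dots,x_{d+1}\in A$. For a clone $C$ on a finite set containing a near-unanimity operation, $\lambda(C):=\min\{m\in\mathbb{N}\mid C=\mathrm{Clo}(C^{(m)})\}$ (this exists by the Baker–Pixley theorem). For $d\ge2$, $n\ge 2$, let $\mathcal{C}^d_n$ be the set of all clones on $\{0,\dots,n-1\}$ that contain a $(d+1)$-ary conservative near-unanimity operation (a finite set, as a consequence of the Baker–Pixley theorem), and $\gamma_d(n):=\max\{\lambda(C)\mid C\in\mathcal{C}^d_n\}$. Thus $\gamma_2(n)$ concerns clones containing a ternary conservative near-unanimity operation. *)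

theory Defs
  imports Main "HOL-Library.FuncSet"
begin

text \<open>
  An operation on a set \<open>A\<close> is a pair of its arity \<open>m\<close> and a function on lists. The function is
  extensional (it is \<open>undefined\<close> off \<open>tuples A m\<close>), so that operations agreeing on \<open>A\<close> are equal.
  The arity is stored explicitly because the extensional function alone need not determine it:
  \<open>undefined\<close> may itself be an element of \<open>A\<close>.
\<close>

type_synonym 'a operation = "nat \<times> ('a list \<Rightarrow> 'a)"

definition tuples :: "'a set \<Rightarrow> nat \<Rightarrow> 'a list set" where
  "tuples A m = {xs. length xs = m \<and> set xs \<subseteq> A}"

definition all_operations :: "'a set \<Rightarrow> 'a operation set" where
  "all_operations A = (SIGMA m:{1..}. tuples A m \<rightarrow>\<^sub>E A)"

definition arity_part :: "'a operation set \<Rightarrow> nat \<Rightarrow> 'a operation set" where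
  "arity_part F m = {\<phi> \<in> F. fst \<phi> = m}"

text \<open>Coordinates are numbered from \<open>0\<close>.\<close>

definition projection :: "'a set \<Rightarrow> nat \<Rightarrow> nat \<Rightarrow> 'a operation" where
  "projection A m i = (m, \<lambda>xs\<in>tuples A m. xs ! i)"

definition compose_operation ::
    "'a set \<Rightarrow> nat \<Rightarrow> ('a list \<Rightarrow> 'a) \<Rightarrow> ('a list \<Rightarrow> 'a) list \<Rightarrow> 'a operation" where
  "compose_operation A m' f gs = (m', \<lambda>xs\<in>tuples A m'. f (map (\<lambda>g. g xs) gs))"

definition is_clone :: "'a set \<Rightarrow> 'a operation set \<Rightarrow> bool" where
  "is_clone A C \<longleftrightarrow>
     C \<subseteq> all_operations A \<and>
     (\<forall>m\<ge>1. \<forall>i<m. projection A m i \<in> C) \<and>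
     (\<forall>m f m' gs. (m, f) \<in> C \<longrightarrow> length gs = m \<longrightarrow> (\<forall>g\<in>set gs. (m', g) \<in> C) \<longrightarrow>
        compose_operation A m' f gs \<in> C)"

definition Clo :: "'a set \<Rightarrow> 'a operation set \<Rightarrow> 'a operation set" where
  "Clo A F = \<Inter>{C. is_clone A C \<and> F \<subseteq> C}"

definition near_unanimity :: "'a set \<Rightarrow> nat \<Rightarrow> ('a list \<Rightarrow> 'a) \<Rightarrow> bool" where
  "near_unanimity A d g \<longleftrightarrow>
     (\<forall>x\<in>A. \<forall>y\<in>A. \<forall>i<d + 1. g ((replicate (d + 1) x)[i := y]) = x)"

definition conservative :: "'a set \<Rightarrow> nat \<Rightarrow> ('a list \<Rightarrow> 'a) \<Rightarrow> bool" where
  "conservative A m g \<longleftrightarrow> (\<forall>xs\<in>tuples A m. g xs \<in> set xs)"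

text \<open>
  The least \<open>m\<close> exists (Baker--Pixley) when \<open>C\<close> is a clone on a finite set containing a
  near-unanimity operation; otherwise the value carries no meaning.
\<close>

definition generation_arity :: "'a set \<Rightarrow> 'a operation set \<Rightarrow> nat" where
  "generation_arity A C = (LEAST m. m \<ge> 1 \<and> C = Clo A (arity_part C m))"

definition conservative_nu_clones :: "nat \<Rightarrow> nat \<Rightarrow> nat operation set set" where
  "conservative_nu_clones d n =
     {C. is_clone {0..<n} C \<and>
         (\<exists>g. (d + 1, g) \<in> C \<and> near_unanimity {0..<n} d g \<and> conservative {0..<n} (d + 1) g)}"

text \<open>
  Intended for \<open>d \<ge> 2\<close> and \<open>n \<ge> 2\<close>, where the maximum is over a finite nonempty set; finiteness is
  a consequence of the Baker--Pixley theorem and is not built into the definition.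
\<close>

definition gamma :: "nat \<Rightarrow> nat \<Rightarrow> nat" where
  "gamma d n = Max {generation_arity {0..<n} C | C. C \<in> conservative_nu_clones d n}"

end

theory Submission
  imports Defs
begin

text \<open>
  The bound is witnessed by one clone for each \<open>n\<close>. Let \<open>S\<close> be the binary relation on
  \<open>{0, ..., n - 1}\<close> that consists of the pairs with a zero coordinate together with \<open>(1, 1)\<close> and
  \<open>(2, 2)\<close>, and let \<open>X = S - {(0, 0)}\<close>, a set of exactly \<open>2 n\<close> pairs. The clone \<open>C\<close> consists of all
  operations that preserve \<open>S - {r}\<close> for every \<open>r\<close> in \<open>X\<close>.

  An operation of \<open>C\<close> of arity less than \<open>2 n\<close>, applied to pairs of \<open>S\<close>, misses some \<open>r\<close> in \<open>X\<close> among
  its arguments, and therefore its value lies in \<open>S - {r}\<close>. So the operations of \<open>C\<close> of any fixed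
  arity less than \<open>2 n\<close> preserve \<open>S\<close>, and so does the clone generated by them
  (\<open>low_arity_preserves_star\<close>). On the other hand, \<open>C\<close> contains a \<open>2 n\<close>-ary operation that does not
  preserve \<open>S\<close>: the one that maps the list of the first coordinates of \<open>X\<close> and the list of the
  second coordinates to \<open>3\<close>, and everything else to \<open>0\<close>. Applied to an enumeration of \<open>X\<close> it
  yields \<open>(3, 3)\<close>, which is not in \<open>S\<close>; if some \<open>r\<close> in \<open>X\<close> is left out, it yields only \<open>(0, 0)\<close> or a
  pair \<open>(3, 0)\<close> or \<open>(0, 3)\<close> that was already an argument (\<open>star_op_in_star_clone\<close>).

  Finally, \<open>C\<close> contains a conservative majority operation (\<open>maj_star\<close>): on three distinct arguments
  it never takes the values \<open>1\<close> and \<open>2\<close>, and it takes the value \<open>0\<close> as soon as \<open>0\<close> is an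
  argument.

  It remains to see that the quantities in the statement are the intended ones, that is, that \<open>C\<close> is
  generated by its operations of some fixed arity and that there are only finitely many clones with
  a majority operation. Both follow from the theorem of Baker and Pixley: an operation
  belongs to a clone with a majority operation as soon as it agrees on any two arguments with some
  operation of the clone.
\<close>

section \<open>Clones and binary relations\<close>

text \<open>
  The operation \<open>f\<close> of arity \<open>k\<close> preserves \<open>R\<close> if, applied coordinatewise to \<open>k\<close> pairs of \<open>R\<close>, it yields
  a pair of \<open>R\<close>.
\<close>

definition preserves :: "nat \<Rightarrow> ('a list \<Rightarrow> 'a) \<Rightarrow> ('a \<times> 'a) set \<Rightarrow> bool" where
  "preserves k f R \<longleftrightarrow>
     (\<forall>s. length s = k \<longrightarrow> set s \<subseteq> R \<longrightarrow> (f (map fst s), f (map snd s)) \<in> R)"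

text \<open>The polymorphisms of a set of binary relations.\<close>

definition Pol :: "'a set \<Rightarrow> ('a \<times> 'a) set set \<Rightarrow> 'a operation set" where
  "Pol A \<R> = {(k, f). (k, f) \<in> all_operations A \<and> (\<forall>R\<in>\<R>. preserves k f R)}"

text \<open>The binary invariant relations of a set of operations.\<close>

definition Inv :: "'a set \<Rightarrow> 'a operation set \<Rightarrow> ('a \<times> 'a) set set" where
  "Inv A C = {R. R \<subseteq> A \<times> A \<and> (\<forall>(k, f)\<in>C. preserves k f R)}"

lemma all_operations_iff:
  "(k, f) \<in> all_operations A \<longleftrightarrow> k \<ge> 1 \<and> f \<in> tuples A k \<rightarrow>\<^sub>E A"
  by (auto simp: all_operations_def)

lemma projection_in_all_operations:
  "i < m \<Longrightarrow> projection A m i \<in> all_operations A"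
  by (auto simp: projection_def all_operations_iff tuples_def)

lemma compose_in_all_operations:
  assumes "(m, f) \<in> all_operations A" "length gs = m" "\<forall>g\<in>set gs. (m', g) \<in> all_operations A"
  shows "compose_operation A m' f gs \<in> all_operations A"
proof -
  from assms(1,2) have "gs \<noteq> []" by (auto simp: all_operations_iff)
  then have m': "m' \<ge> 1" using assms(3) by (cases gs) (auto simp: all_operations_iff)
  have "f (map (\<lambda>g. g xs) gs) \<in> A" if "xs \<in> tuples A m'" for xs
  proof -
    have "map (\<lambda>g. g xs) gs \<in> tuples A m"
      using assms(2,3) that by (auto simp: tuples_def all_operations_iff)
    then show ?thesis using assms(1) by (auto simp: all_operations_iff)
  qed
  with m' show ?thesis by (auto simp: compose_operation_def all_operations_iff)
qed

lemma is_clone_Pol: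
  assumes "\<And>R. R \<in> \<R> \<Longrightarrow> R \<subseteq> A \<times> A"
  shows "is_clone A (Pol A \<R>)"
  unfolding is_clone_def
proof (intro conjI allI impI)
  show "Pol A \<R> \<subseteq> all_operations A" by (auto simp: Pol_def)
next
  fix m i :: nat assume "1 \<le> m" "i < m"
  have in_tuples: "map fst s \<in> tuples A m \<and> map snd s \<in> tuples A m"
    if "length s = m" "set s \<subseteq> R" "R \<in> \<R>" for s R m
    using that assms[of R] by (auto simp: tuples_def)
  have "preserves m (\<lambda>xs\<in>tuples A m. xs ! i) R" if "R \<in> \<R>" for R
    unfolding preserves_def
  proof (intro allI impI)
    fix s :: "('a \<times> 'a) list" assume s: "length s = m" "set s \<subseteq> R"
    then have "s ! i \<in> R" using \<open>i < m\<close> by auto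
    then show "((\<lambda>xs\<in>tuples A m. xs ! i) (map fst s), (\<lambda>xs\<in>tuples A m. xs ! i) (map snd s)) \<in> R"
      using in_tuples[OF s that] s \<open>i < m\<close> by simp
  qed
  then show "projection A m i \<in> Pol A \<R>"
    using projection_in_all_operations[OF \<open>i < m\<close>, of A] by (auto simp: Pol_def projection_def)
next
  fix m f m' gs
  assume f: "(m, f) \<in> Pol A \<R>" and gs: "length gs = m" "\<forall>g\<in>set gs. (m', g) \<in> Pol A \<R>"
  have "preserves m' (\<lambda>xs\<in>tuples A m'. f (map (\<lambda>g. g xs) gs)) R" if R: "R \<in> \<R>" for R
    unfolding preserves_def
  proof (intro allI impI)
    fix s :: "('a \<times> 'a) list" assume s: "length s = m'" "set s \<subseteq> R"
    define s' where "s' = map (\<lambda>g. (g (map fst s), g (map snd s))) gs"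
    have "length s' = m" "set s' \<subseteq> R"
      using gs s R by (auto simp: s'_def Pol_def preserves_def)
    then have "(f (map fst s'), f (map snd s')) \<in> R"
      using f R by (auto simp: Pol_def preserves_def)
    moreover have "map fst s \<in> tuples A m'" "map snd s \<in> tuples A m'"
      using s assms[OF R] by (auto simp: tuples_def)
    ultimately show "((\<lambda>xs\<in>tuples A m'. f (map (\<lambda>g. g xs) gs)) (map fst s),
        (\<lambda>xs\<in>tuples A m'. f (map (\<lambda>g. g xs) gs)) (map snd s)) \<in> R"
      by (simp add: s'_def comp_def)
  qed
  moreover have "compose_operation A m' f gs \<in> all_operations A"
    using f gs by (intro compose_in_all_operations) (auto simp: Pol_def)
  ultimately show "compose_operation A m' f gs \<in> Pol A \<R>"
    by (auto simp: Pol_def compose_operation_def)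
qed

lemma Clo_least: "is_clone A C \<Longrightarrow> F \<subseteq> C \<Longrightarrow> Clo A F \<subseteq> C"
  by (auto simp: Clo_def)

lemma Clo_extensive: "F \<subseteq> Clo A F"
  by (auto simp: Clo_def)

text \<open>
  The intersection in the definition of \<open>Clo\<close> ranges over a nonempty family only if some clone contains
  \<open>F\<close>; this is the role of \<open>C\<close>.
\<close>

lemma is_clone_Clo:
  assumes "is_clone A C" "F \<subseteq> C"
  shows "is_clone A (Clo A F)"
proof -
  have "Clo A F \<subseteq> C" by (rule Clo_least[OF assms])
  then have "Clo A F \<subseteq> all_operations A" using assms(1) by (auto simp: is_clone_def)
  moreover have "projection A m i \<in> Clo A F" if "m \<ge> 1" "i < m" for m i
    using that by (auto simp: Clo_def is_clone_def)
  moreover have "compose_operation A m' f gs \<in> Clo A F"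
    if "(m, f) \<in> Clo A F" "length gs = m" "\<forall>g\<in>set gs. (m', g) \<in> Clo A F" for m f m' gs
    unfolding Clo_def
  proof (rule InterI)
    fix D assume "D \<in> {C. is_clone A C \<and> F \<subseteq> C}"
    then have D: "is_clone A D" "Clo A F \<subseteq> D" by (auto simp: Clo_def)
    then have "(m, f) \<in> D" "\<forall>g\<in>set gs. (m', g) \<in> D" using that by auto
    then show "compose_operation A m' f gs \<in> D"
      using D(1) that(2) unfolding is_clone_def by blast
  qed
  ultimately show ?thesis by (simp add: is_clone_def)
qed

lemma is_clone_subset: "is_clone A C \<Longrightarrow> C \<subseteq> all_operations A"
  by (simp add: is_clone_def)

lemma is_clone_in_carrier: "is_clone A C \<Longrightarrow> (k, f) \<in> C \<Longrightarrow> xs \<in> tuples A k \<Longrightarrow> f xs \<in> A"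
  using is_clone_subset[of A C] all_operations_iff[of k f A] by blast

lemma is_clone_op: "is_clone A C \<Longrightarrow> (k, f) \<in> C \<Longrightarrow> k \<ge> 1 \<and> f \<in> tuples A k \<rightarrow>\<^sub>E A"
  using is_clone_subset[of A C] all_operations_iff[of k f A] by blast

lemma is_clone_projection: "is_clone A C \<Longrightarrow> i < m \<Longrightarrow> projection A m i \<in> C"
  by (simp add: is_clone_def)

lemma is_clone_compose:
  "is_clone A C \<Longrightarrow> (m, f) \<in> C \<Longrightarrow> length gs = m \<Longrightarrow> \<forall>g\<in>set gs. (m', g) \<in> C
    \<Longrightarrow> compose_operation A m' f gs \<in> C"
  unfolding is_clone_def by blast

text \<open>A clone is closed under permuting, identifying and adding variables.\<close>

lemma is_clone_substitute:
  assumes "is_clone A C" "(m, f) \<in> C" "\<And>i. i < m \<Longrightarrow> \<sigma> i < k"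
  shows "(k, \<lambda>xs\<in>tuples A k. f (map (\<lambda>i. xs ! \<sigma> i) [0..<m])) \<in> C"
proof -
  define gs where "gs = map (\<lambda>i. snd (projection A k (\<sigma> i))) [0..<m]"
  have "\<forall>g\<in>set gs. (k, g) \<in> C"
    using is_clone_projection[OF assms(1)] assms(3) by (auto simp: gs_def projection_def)
  then have "compose_operation A k f gs \<in> C"
    using assms by (intro is_clone_compose[of A C m]) (auto simp: gs_def)
  also have "compose_operation A k f gs = (k, \<lambda>xs\<in>tuples A k. f (map (\<lambda>i. xs ! \<sigma> i) [0..<m]))"
    by (auto simp: compose_operation_def gs_def projection_def fun_eq_iff restrict_def comp_def)
  finally show ?thesis .
qed

section \<open>Clones with a majority operation\<close>

lemma near_unanimity_2:
  assumes "near_unanimity A 2 g" "x \<in> A" "y \<in> A"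
  shows "g [y, x, x] = x" "g [x, y, x] = x" "g [x, x, y] = x"
proof -
  have g: "g ((replicate 3 x)[i := y]) = x" if "i < 3" for i
    using assms that by (auto simp: near_unanimity_def)
  show "g [y, x, x] = x" "g [x, y, x] = x" "g [x, x, y] = x"
    using g[of 0] g[of 1] g[of 2] by (simp_all add: numeral_3_eq_3 numeral_2_eq_2)
qed

text \<open>
  Interpolation on pairs extends to finite sets of arguments: if \<open>h1\<close>, \<open>h2\<close>, \<open>h3\<close> agree with \<open>f\<close> on \<open>S\<close>
  except possibly at \<open>p\<close>, \<open>q\<close>, \<open>r\<close> respectively, then at every point of \<open>S\<close> at least two of them are
  right, and the majority operation corrects the third.
\<close>

lemma Baker_Pixley_interpolation:
  assumes C: "is_clone A C" and g: "(3, g) \<in> C" "near_unanimity A 2 g"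
    and f: "f \<in> tuples A k \<rightarrow>\<^sub>E A"
    and two: "\<And>x y. x \<in> tuples A k \<Longrightarrow> y \<in> tuples A k \<Longrightarrow> \<exists>h. (k, h) \<in> C \<and> h x = f x \<and> h y = f y"
    and S: "finite S" "S \<subseteq> tuples A k" "S \<noteq> {}"
  shows "\<exists>h. (k, h) \<in> C \<and> (\<forall>x\<in>S. h x = f x)"
  using S
proof (induction "card S" arbitrary: S rule: less_induct)
  case less
  show ?case
  proof (cases "\<exists>p q. S = {p, q}")
    case True
    then obtain p q where "S = {p, q}" by blast
    with two[of p q] less.prems show ?thesis by auto
  next
    case False
    then have neq: "S \<noteq> {p, q}" for p q by blast
    obtain p where p: "p \<in> S" using \<open>S \<noteq> {}\<close> by auto
    obtain q where q: "q \<in> S" "q \<noteq> p" using neq[of p p] p by auto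
    obtain r where r: "r \<in> S" "r \<noteq> p" "r \<noteq> q" using neq[of p q] p q by auto
    have step: "\<exists>h. (k, h) \<in> C \<and> (\<forall>x\<in>S - {z}. h x = f x)" if "z \<in> S" for z
    proof (rule less.hyps)
      show "card (S - {z}) < card S" using that less.prems(1) by (meson card_Diff1_less)
      show "S - {z} \<noteq> {}" using neq[of z z] that by auto
    qed (use less.prems in auto)
    obtain h1 where h1: "(k, h1) \<in> C" "\<forall>x\<in>S - {p}. h1 x = f x" using step[OF p] by auto
    obtain h2 where h2: "(k, h2) \<in> C" "\<forall>x\<in>S - {q}. h2 x = f x" using step[OF q(1)] by auto
    obtain h3 where h3: "(k, h3) \<in> C" "\<forall>x\<in>S - {r}. h3 x = f x" using step[OF r(1)] by auto
    define h where "h = (\<lambda>xs\<in>tuples A k. g (map (\<lambda>g. g xs) [h1, h2, h3]))"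
    have "compose_operation A k g [h1, h2, h3] \<in> C"
      using h1 h2 h3 g C by (intro is_clone_compose[of A C 3]) auto
    then have "(k, h) \<in> C" by (simp add: compose_operation_def h_def)
    moreover have "h x = f x" if x: "x \<in> S" for x
    proof -
      have xt: "x \<in> tuples A k" using x less.prems by auto
      have A: "f x \<in> A" "h1 x \<in> A" "h2 x \<in> A" "h3 x \<in> A"
        using xt f h1(1) h2(1) h3(1) is_clone_in_carrier[OF C] by auto
      have hx: "h x = g [h1 x, h2 x, h3 x]" using xt by (simp add: h_def)
      consider "x = p" | "x = q" | "x \<noteq> p" "x \<noteq> q" by blast
      then show ?thesis
      proof cases
        case 1
        then have "h2 x = f x" "h3 x = f x" using h2 h3 p q r by auto
        then show ?thesis using near_unanimity_2[OF g(2)] A hx by simp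
      next
        case 2
        then have "h1 x = f x" "h3 x = f x" using h1 h3 p q r by auto
        then show ?thesis using near_unanimity_2[OF g(2)] A hx by simp
      next
        case 3
        then have "h1 x = f x" "h2 x = f x" using h1 h2 x by auto
        then show ?thesis using near_unanimity_2[OF g(2)] A hx by simp
      qed
    qed
    ultimately show ?thesis by blast
  qed
qed

lemma finite_tuples: "finite A \<Longrightarrow> finite (tuples A k)"
  using finite_lists_length_eq[of A k] by (simp add: tuples_def conj_commute)

lemma Baker_Pixley:
  assumes C: "is_clone A C" and g: "(3, g) \<in> C" "near_unanimity A 2 g" and "finite A"
    and f: "(k, f) \<in> all_operations A"
    and two: "\<And>x y. x \<in> tuples A k \<Longrightarrow> y \<in> tuples A k \<Longrightarrow> \<exists>h. (k, h) \<in> C \<and> h x = f x \<and> h y = f y"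
  shows "(k, f) \<in> C"
proof -
  have f': "f \<in> tuples A k \<rightarrow>\<^sub>E A" "k \<ge> 1" using f by (auto simp: all_operations_iff)
  obtain h where h: "(k, h) \<in> C" "\<forall>x\<in>tuples A k. h x = f x"
  proof (cases "tuples A k = {}")
    case True
    with is_clone_projection[OF C, of 0 k] f'(2) that show ?thesis
      by (auto simp: projection_def)
  next
    case False
    with Baker_Pixley_interpolation[OF C g f'(1) two, of "tuples A k"] finite_tuples[OF \<open>finite A\<close>] that
    show ?thesis by auto
  qed
  have "h \<in> tuples A k \<rightarrow>\<^sub>E A" using is_clone_op[OF C h(1)] by simp
  then have "h = f" using f'(1) h(2) by (intro PiE_ext) auto
  with h(1) show ?thesis by simp
qed

text \<open>
  A clone with a majority operation is determined by its binary invariant relations. Two-point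
  interpolation at \<open>x\<close> and \<open>y\<close> comes from the invariant relation generated by the pairs \<open>(x ! i, y ! i)\<close>.
\<close>

lemma Pol_Inv:
  assumes C: "is_clone A C" and g: "(3, g) \<in> C" "near_unanimity A 2 g" and A: "finite A"
  shows "Pol A (Inv A C) = C"
proof
  show "C \<subseteq> Pol A (Inv A C)"
    using is_clone_subset[OF C] by (auto simp: Pol_def Inv_def)
next
  show "Pol A (Inv A C) \<subseteq> C"
  proof
    fix \<phi> assume "\<phi> \<in> Pol A (Inv A C)"
    then obtain k f where \<phi>: "\<phi> = (k, f)" and f: "(k, f) \<in> all_operations A"
      and pres: "\<And>R. R \<in> Inv A C \<Longrightarrow> preserves k f R" by (auto simp: Pol_def)
    have "(k, f) \<in> C"
    proof (rule Baker_Pixley[OF C g A f])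
      fix x y assume xy: "x \<in> tuples A k" "y \<in> tuples A k"
      define R where "R = {(h x, h y) | h. (k, h) \<in> C}"
      have "R \<subseteq> A \<times> A"
        using xy is_clone_in_carrier[OF C] by (auto simp: R_def)
      moreover have "preserves m u R" if u: "(m, u) \<in> C" for m u
        unfolding preserves_def
      proof (intro allI impI)
        fix s assume s: "length s = m" "set s \<subseteq> R"
        then have "\<forall>p\<in>set s. \<exists>h. (k, h) \<in> C \<and> p = (h x, h y)" by (auto simp: R_def)
        then obtain H where H: "\<forall>p\<in>set s. (k, H p) \<in> C \<and> p = (H p x, H p y)" by metis
        have "compose_operation A k u (map H s) \<in> C"
          using s H by (intro is_clone_compose[OF C u]) auto
        moreover have "map fst s = map (\<lambda>g. g x) (map H s)" "map snd s = map (\<lambda>g. g y) (map H s)"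
          using H by (auto simp: comp_def intro: arg_cong[of _ _ fst] arg_cong[of _ _ snd])
        ultimately show "(u (map fst s), u (map snd s)) \<in> R"
          using xy unfolding R_def compose_operation_def
          by (intro CollectI exI[of _ "\<lambda>xs\<in>tuples A k. u (map (\<lambda>g. g xs) (map H s))"]) (simp del: map_map)
      qed
      ultimately have "R \<in> Inv A C" by (auto simp: Inv_def)
      then have "preserves k f R" by (rule pres)
      moreover have "set (zip x y) \<subseteq> R"
      proof
        fix p assume "p \<in> set (zip x y)"
        then obtain i where i: "i < k" "p = (x ! i, y ! i)"
          using xy by (auto simp: set_zip tuples_def)
        then have "projection A k i \<in> C" using is_clone_projection[OF C] by simp
        then show "p \<in> R" using i xy unfolding R_def projection_def
          by (auto intro!: exI[of _ "\<lambda>xs\<in>tuples A k. xs ! i"])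
      qed
      ultimately have "(f x, f y) \<in> R"
        using xy unfolding preserves_def
        by (elim allE[of _ "zip x y"]) (simp add: tuples_def)
      then show "\<exists>h. (k, h) \<in> C \<and> h x = f x \<and> h y = f y" by (auto simp: R_def)
    qed
    with \<phi> show "\<phi> \<in> C" by simp
  qed
qed

lemma finite_majority_clones:
  assumes "finite A"
  shows "finite {C. is_clone A C \<and> (\<exists>g. (3, g) \<in> C \<and> near_unanimity A 2 g)}" (is "finite ?M")
proof (rule finite_imageD)
  show "finite (Inv A ` ?M)"
    by (rule finite_subset[of _ "Pow (Pow (A \<times> A))"]) (use assms in \<open>auto simp: Inv_def\<close>)
  show "inj_on (Inv A) ?M"
  proof (rule inj_onI)
    fix C D assume "C \<in> ?M" "D \<in> ?M" and eq: "Inv A C = Inv A D"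
    then have "Pol A (Inv A C) = C" "Pol A (Inv A D) = D" using Pol_Inv[OF _ _ _ assms] by blast+
    with eq show "C = D" by metis
  qed
qed

text \<open>
  If \<open>f\<close> depends, after an identification of variables, only on \<open>N\<close> of them, then it is a minor of
  an \<open>N\<close>-ary operation. Here \<open>\<sigma>\<close> sends each variable to its class, numbered below \<open>N\<close>, and \<open>\<rho>\<close> picks a
  representative of each class.
\<close>

lemma is_clone_factor:
  assumes C: "is_clone A C" and f: "(k, f) \<in> C" and "N \<ge> 1"
    and \<sigma>: "\<And>i. i < k \<Longrightarrow> \<sigma> i < N" and \<rho>: "\<And>j. j < N \<Longrightarrow> \<rho> j < k"
  shows "(k, \<lambda>xs\<in>tuples A k. f (map (\<lambda>i. xs ! \<rho> (\<sigma> i)) [0..<k])) \<in> Clo A (arity_part C N)"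
proof -
  have "arity_part C N \<subseteq> C" by (auto simp: arity_part_def)
  note Clo = is_clone_Clo[OF C this]
  define h where "h = (\<lambda>xs\<in>tuples A N. f (map (\<lambda>i. xs ! \<sigma> i) [0..<k]))"
  have "(N, h) \<in> C" unfolding h_def by (rule is_clone_substitute[OF C f \<sigma>])
  then have "(N, h) \<in> Clo A (arity_part C N)"
    using Clo_extensive[of "arity_part C N" A] by (auto simp: arity_part_def)
  from is_clone_substitute[OF Clo this \<rho>]
  have "(k, \<lambda>xs\<in>tuples A k. h (map (\<lambda>j. xs ! \<rho> j) [0..<N])) \<in> Clo A (arity_part C N)" .
  also have "(\<lambda>xs\<in>tuples A k. h (map (\<lambda>j. xs ! \<rho> j) [0..<N])) =
    (\<lambda>xs\<in>tuples A k. f (map (\<lambda>i. xs ! \<rho> (\<sigma> i)) [0..<k]))"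
  proof (rule restrict_ext)
    fix xs assume xs: "xs \<in> tuples A k"
    have "map (\<lambda>j. xs ! \<rho> j) [0..<N] \<in> tuples A N"
      using xs \<rho> by (auto simp: tuples_def)
    moreover have "map (\<lambda>i. map (\<lambda>j. xs ! \<rho> j) [0..<N] ! \<sigma> i) [0..<k] = map (\<lambda>i. xs ! \<rho> (\<sigma> i)) [0..<k]"
      using \<sigma> by simp
    ultimately show "h (map (\<lambda>j. xs ! \<rho> j) [0..<N]) = f (map (\<lambda>i. xs ! \<rho> (\<sigma> i)) [0..<k])"
      by (simp only: h_def restrict_apply' if_True)
  qed
  finally show ?thesis .
qed

lemma low_arity_in_Clo:
  assumes C: "is_clone A C" and f: "(k, f) \<in> C" and "k \<le> N"
  shows "(k, f) \<in> Clo A (arity_part C N)"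
proof -
  have f': "k \<ge> 1" "f \<in> tuples A k \<rightarrow>\<^sub>E A"
    using is_clone_op[OF C f] by simp_all
  have "(k, \<lambda>xs\<in>tuples A k. f (map (\<lambda>i. xs ! min i (k - 1)) [0..<k])) \<in> Clo A (arity_part C N)"
    using f' \<open>k \<le> N\<close> by (intro is_clone_factor[OF C f, of N "\<lambda>i. i" "\<lambda>j. min j (k - 1)"]) auto
  also have "(\<lambda>xs\<in>tuples A k. f (map (\<lambda>i. xs ! min i (k - 1)) [0..<k])) = f"
  proof (rule PiE_ext[of _ "tuples A k" "\<lambda>_. A"])
    have eq: "map (\<lambda>i. xs ! min i (k - 1)) [0..<k] = xs" if "xs \<in> tuples A k" for xs
      using that f'(1) by (auto simp: tuples_def intro!: nth_equalityI)
    then show "(\<lambda>xs\<in>tuples A k. f (map (\<lambda>i. xs ! min i (k - 1)) [0..<k])) \<in> tuples A k \<rightarrow>\<^sub>E A"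
      using f'(2) by auto
    show "(\<lambda>xs\<in>tuples A k. f (map (\<lambda>i. xs ! min i (k - 1)) [0..<k])) xs = f xs"
      if "xs \<in> tuples A k" for xs using that eq by simp
  qed (rule f'(2))
  finally show ?thesis .
qed

text \<open>
  A pair of \<open>k\<close>-tuples \<open>x\<close>, \<open>y\<close> has at most \<open>card (A \<times> A)\<close> distinct columns \<open>(x ! i, y ! i)\<close>. Identifying
  the variables with equal columns does not change the values at \<open>x\<close> and \<open>y\<close>, so operations of
  arity \<open>card (A \<times> A)\<close> suffice for interpolation on two points; the summand \<open>3\<close> makes room for the
  majority operation.
\<close>

lemma majority_clone_generated:
  assumes C: "is_clone A C" and g: "(3, g) \<in> C" "near_unanimity A 2 g" and A: "finite A"
  shows "C = Clo A (arity_part C (card (A \<times> A) + 3))" (is "C = Clo A (arity_part C ?N)")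
proof
  have sub: "arity_part C ?N \<subseteq> C" by (auto simp: arity_part_def)
  then show "Clo A (arity_part C ?N) \<subseteq> C" by (rule Clo_least[OF C])
  have Clo: "is_clone A (Clo A (arity_part C ?N))" by (rule is_clone_Clo[OF C sub])
  have gClo: "(3, g) \<in> Clo A (arity_part C ?N)" by (rule low_arity_in_Clo[OF C g(1)]) simp
  show "C \<subseteq> Clo A (arity_part C ?N)"
  proof
    fix \<phi> assume "\<phi> \<in> C"
    then obtain k f where \<phi>: "\<phi> = (k, f)" and f: "(k, f) \<in> C" by (cases \<phi>) auto
    have fO: "(k, f) \<in> all_operations A" using f is_clone_subset[OF C] by auto
    have "(k, f) \<in> Clo A (arity_part C ?N)"
    proof (rule Baker_Pixley[OF Clo gClo g(2) A fO])
      fix x y assume xy: "x \<in> tuples A k" "y \<in> tuples A k"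
      obtain e where e: "bij_betw e (A \<times> A) {0..<card (A \<times> A)}"
        using ex_bij_betw_finite_nat[of "A \<times> A"] A by auto
      \<comment> \<open>\<open>\<sigma> i\<close> numbers the \<open>i\<close>-th column; the value \<open>0\<close> of \<open>\<rho>\<close> at numbers of no column is arbitrary\<close>
      define \<sigma> where "\<sigma> i = e (x ! i, y ! i)" for i
      define \<rho> where "\<rho> j = (if \<exists>i<k. \<sigma> i = j then SOME i. i < k \<and> \<sigma> i = j else 0)" for j
      have in_A: "(x ! i, y ! i) \<in> A \<times> A" if "i < k" for i
        using xy that by (auto simp: tuples_def)
      have \<sigma>: "\<sigma> i < ?N" if "i < k" for i
        using bij_betwE[OF e] in_A[OF that] by (fastforce simp: \<sigma>_def)
      have \<rho>': "\<rho> (\<sigma> i) < k \<and> \<sigma> (\<rho> (\<sigma> i)) = \<sigma> i" if "i < k" for i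
      proof -
        have ex: "\<exists>i'<k. \<sigma> i' = \<sigma> i" using that by auto
        then have "\<rho> (\<sigma> i) = (SOME i'. i' < k \<and> \<sigma> i' = \<sigma> i)" by (simp add: \<rho>_def)
        with someI_ex[OF ex] show ?thesis by simp
      qed
      have \<rho>: "\<rho> j < k" for j
      proof (cases "\<exists>i<k. \<sigma> i = j")
        case True
        then show ?thesis using \<rho>' by blast
      next
        case False
        then have "\<rho> j = 0" unfolding \<rho>_def by (rule if_not_P)
        then show ?thesis using fO by (simp add: all_operations_iff)
      qed
      have same: "x ! \<rho> (\<sigma> i) = x ! i \<and> y ! \<rho> (\<sigma> i) = y ! i" if "i < k" for i
      proof -
        have "e (x ! \<rho> (\<sigma> i), y ! \<rho> (\<sigma> i)) = e (x ! i, y ! i)"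
          using \<rho>'[OF that] by (simp only: \<sigma>_def)
        from inj_onD[OF bij_betw_imp_inj_on[OF e] this in_A[OF \<rho>] in_A[OF that]]
        show ?thesis by simp
      qed
      define h where "h = (\<lambda>xs\<in>tuples A k. f (map (\<lambda>i. xs ! \<rho> (\<sigma> i)) [0..<k]))"
      have "(k, h) \<in> Clo A (arity_part C ?N)"
        unfolding h_def using \<sigma> \<rho> by (intro is_clone_factor[OF C f]) auto
      moreover have "map (\<lambda>i. x ! \<rho> (\<sigma> i)) [0..<k] = x" "map (\<lambda>i. y ! \<rho> (\<sigma> i)) [0..<k] = y"
        using xy same by (auto simp: tuples_def intro!: nth_equalityI)
      then have "h x = f x" "h y = f y" using xy by (simp_all add: h_def)
      ultimately show "\<exists>h. (k, h) \<in> Clo A (arity_part C ?N) \<and> h x = f x \<and> h y = f y" by blast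
    qed
    with \<phi> show "\<phi> \<in> Clo A (arity_part C ?N)" by simp
  qed
qed

section \<open>A clone that needs operations of arity twice the size of the set\<close>

text \<open>The relation \<open>S\<close>: a star with centre \<open>0\<close> together with loops at \<open>1\<close> and \<open>2\<close>.\<close>

definition star :: "nat \<Rightarrow> (nat \<times> nat) set" where
  "star n = {(x, y). x < n \<and> y < n \<and> (x = 0 \<or> y = 0 \<or> x = y \<and> x \<in> {1, 2})}"

text \<open>
  An enumeration of the \<open>2 n\<close> pairs of \<open>star n\<close> other than \<open>(0, 0)\<close>. The order is immaterial, but
  it fixes the two tuples at which \<open>star_op\<close> below is nonzero.
\<close>

definition star_list :: "nat \<Rightarrow> (nat \<times> nat) list" where
  "star_list n = map (\<lambda>y. (0, y)) [1..<n] @ map (\<lambda>x. (x, 0)) [1..<n] @ [(1, 1), (2, 2)]"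

text \<open>The clone \<open>C\<close> of operations that preserve \<open>star n - {r}\<close> for each \<open>r\<close> in \<open>star n - {(0, 0)}\<close>.\<close>

definition star_clone :: "nat \<Rightarrow> nat operation set" where
  "star_clone n = Pol {0..<n} ((\<lambda>r. star n - {r}) ` set (star_list n))"

text \<open>
  The majority if two arguments agree; otherwise \<open>0\<close> if it is an argument, and else the maximum, which
  is then at least \<open>3\<close>. So the values \<open>1\<close> and \<open>2\<close> are taken only as majorities.
\<close>

definition maj :: "nat \<Rightarrow> nat \<Rightarrow> nat \<Rightarrow> nat" where
  "maj x y z = (if x = y \<or> x = z then x else if y = z then y
     else if x = 0 \<or> y = 0 \<or> z = 0 then 0 else max x (max y z))"

definition maj_op :: "nat \<Rightarrow> nat list \<Rightarrow> nat" where
  "maj_op n = (\<lambda>xs\<in>tuples {0..<n} 3. maj (xs ! 0) (xs ! 1) (xs ! 2))"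

text \<open>The \<open>2 n\<close>-ary operation that does not preserve \<open>star n\<close>.\<close>

definition star_op :: "nat \<Rightarrow> nat list \<Rightarrow> nat" where
  "star_op n = (\<lambda>xs\<in>tuples {0..<n} (2 * n).
     if xs = map fst (star_list n) \<or> xs = map snd (star_list n) then 3 else 0)"

lemma set_star_list: "n \<ge> 3 \<Longrightarrow> set (star_list n) = star n - {(0, 0)}"
  by (auto simp: star_list_def star_def)

lemma length_star_list: "n \<ge> 1 \<Longrightarrow> length (star_list n) = 2 * n"
  by (auto simp: star_list_def)

lemma maj_in: "maj x y z \<in> {x, y, z}"
  by (auto simp: maj_def max_def)

lemma maj_less: "x < n \<Longrightarrow> y < n \<Longrightarrow> z < n \<Longrightarrow> maj x y z < n"
  by (simp add: maj_def)

lemma maj_eq_12D: "maj x y z = c \<Longrightarrow> c \<in> {1, 2} \<Longrightarrow> x = c \<and> y = c \<or> x = c \<and> z = c \<or> y = c \<and> z = c"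
  by (auto simp: maj_def max_def split: if_splits)

lemma maj_eq [simp]: "maj x x y = x" "maj x y x = x" "maj y x x = x"
  by (auto simp: maj_def)

lemma maj_nonzeroD:
  assumes "maj x y z = c" "c \<noteq> 0"
  shows "x = c \<and> y = c \<or> x = c \<and> z = c \<or> y = c \<and> z = c \<or>
    x \<noteq> y \<and> x \<noteq> z \<and> y \<noteq> z \<and> x \<noteq> 0 \<and> y \<noteq> 0 \<and> z \<noteq> 0"
proof (cases "x = y \<or> x = z \<or> y = z")
  case True
  then show ?thesis using assms(1) by (elim disjE) simp_all
next
  case False
  then have "x \<noteq> 0 \<and> y \<noteq> 0 \<and> z \<noteq> 0" using assms unfolding maj_def by metis
  with False show ?thesis by simp
qed

text \<open>
  Every pair \<open>r\<close> of the star except \<open>(0, 0)\<close> is irreducible: it arises by \<open>maj\<close> from pairs of the star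
  only if it is one of them. Some coordinate of \<open>r\<close> is either at least \<open>3\<close>, and \<open>r\<close> is
  the only pair with that value there, so conservativity applies; or it is \<open>1\<close> or \<open>2\<close>, it is a
  majority, and only one pair other than \<open>r\<close> has that value there.
\<close>

lemma maj_star:
  assumes r: "r \<in> star n - {(0, 0)}" and s: "{(x1, y1), (x2, y2), (x3, y3)} \<subseteq> star n - {r}"
  shows "(maj x1 x2 x3, maj y1 y2 y3) \<in> star n - {r}"
proof -
  define p q where "p = maj x1 x2 x3" and "q = maj y1 y2 y3"
  have lt: "p < n" "q < n"
    unfolding p_def q_def by (rule maj_less; use s in \<open>simp add: star_def\<close>)+
  have P: "x1 = 0 \<or> y1 = 0 \<or> x1 = y1 \<and> x1 \<in> {1, 2}" "x2 = 0 \<or> y2 = 0 \<or> x2 = y2 \<and> x2 \<in> {1, 2}"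
    "x3 = 0 \<or> y3 = 0 \<or> x3 = y3 \<and> x3 \<in> {1, 2}"
    using s by (simp_all add: star_def)
  have "p = 0 \<or> q = 0 \<or> p = q \<and> p \<in> {1, 2}"
  proof (cases "p = 0 \<or> q = 0")
    case False
    \<comment> \<open>Two majorities share an argument pair, which is then \<open>(p, q)\<close>. If one coordinate has three
      distinct nonzero entries, the pairs with both coordinates nonzero are distinct and among
      \<open>(1, 1)\<close>, \<open>(2, 2)\<close>; this leaves no room for a nonzero value in the other coordinate.\<close>
    then have "p \<noteq> 0" "q \<noteq> 0" by simp_all
    from maj_nonzeroD[OF p_def[symmetric] \<open>p \<noteq> 0\<close>] maj_nonzeroD[OF q_def[symmetric] \<open>q \<noteq> 0\<close>]
    show ?thesis by (elim disjE; use P \<open>p \<noteq> 0\<close> \<open>q \<noteq> 0\<close> in auto)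
  qed auto
  with lt have "(p, q) \<in> star n" by (simp add: star_def)
  moreover have "(p, q) \<noteq> r"
  proof
    assume pq: "(p, q) = r"
    have neq: "(x1, y1) \<noteq> (p, q)" "(x2, y2) \<noteq> (p, q)" "(x3, y3) \<noteq> (p, q)"
      unfolding pq using s by simp_all
    have s': "(x1, y1) \<in> star n" "(x2, y2) \<in> star n" "(x3, y3) \<in> star n" using s by simp_all
    have pq0: "p \<noteq> 0 \<or> q \<noteq> 0" using r unfolding pq[symmetric] by simp
    have inp: "p = x1 \<or> p = x2 \<or> p = x3" and inq: "q = y1 \<or> q = y2 \<or> q = y3"
      using maj_in[of x1 x2 x3] maj_in[of y1 y2 y3] unfolding p_def q_def by simp_all
    consider "p \<in> {1, 2}" | "q \<in> {1, 2}" | "p \<noteq> 0" "p \<notin> {1, 2}" "q = 0" | "q \<noteq> 0" "q \<notin> {1, 2}" "p = 0"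
      using \<open>(p, q) \<in> star n\<close> pq0 by (auto simp: star_def)
    then show False
    proof cases
      case 1
      have row: "y = y'" if "(p, y) \<in> star n" "(p, y') \<in> star n" "y \<noteq> q" "y' \<noteq> q" for y y'
        using that 1 \<open>(p, q) \<in> star n\<close> by (auto simp: star_def)
      have "x1 = p \<and> x2 = p \<or> x1 = p \<and> x3 = p \<or> x2 = p \<and> x3 = p"
        using maj_eq_12D[OF p_def[symmetric] 1] .
      then show False
      proof (elim disjE conjE)
        assume "x1 = p" "x2 = p" then show False using row[of y1 y2] neq s' q_def by simp
      next
        assume "x1 = p" "x3 = p" then show False using row[of y1 y3] neq s' q_def by simp
      next
        assume "x2 = p" "x3 = p" then show False using row[of y2 y3] neq s' q_def by simp
      qed
    next
      case 2
      have column: "x = x'" if "(x, q) \<in> star n" "(x', q) \<in> star n" "x \<noteq> p" "x' \<noteq> p" for x x'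
        using that 2 \<open>(p, q) \<in> star n\<close> by (auto simp: star_def)
      have "y1 = q \<and> y2 = q \<or> y1 = q \<and> y3 = q \<or> y2 = q \<and> y3 = q"
        using maj_eq_12D[OF q_def[symmetric] 2] .
      then show False
      proof (elim disjE conjE)
        assume "y1 = q" "y2 = q" then show False using column[of x1 x2] neq s' p_def by simp
      next
        assume "y1 = q" "y3 = q" then show False using column[of x1 x3] neq s' p_def by simp
      next
        assume "y2 = q" "y3 = q" then show False using column[of x2 x3] neq s' p_def by simp
      qed
    next
      case 3
      have "y = 0" if "(p, y) \<in> star n" for y using that 3 by (auto simp: star_def)
      with inp neq s' \<open>q = 0\<close> show False by metis
    next
      case 4
      have "x = 0" if "(x, q) \<in> star n" for x using that 4 by (auto simp: star_def)
      with inq neq s' \<open>p = 0\<close> show False by metis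
    qed
  qed
  ultimately show ?thesis by (simp add: p_def q_def)
qed

lemma star_subset: "star n \<subseteq> {0..<n} \<times> {0..<n}"
  by (auto simp: star_def)

lemma is_clone_star_clone: "is_clone {0..<n} (star_clone n)"
  unfolding star_clone_def using star_subset by (intro is_clone_Pol) auto

lemma maj_op_in_star_clone:
  assumes "n \<ge> 3"
  shows "(3, maj_op n) \<in> star_clone n"
proof -
  have "maj_op n \<in> tuples {0..<n} 3 \<rightarrow>\<^sub>E {0..<n}"
  proof (rule PiE_I)
    fix xs assume xs: "xs \<in> tuples {0..<n} 3"
    then have "xs ! i < n" if "i < 3" for i
      using that nth_mem[of i xs] by (force simp: tuples_def)
    then have "xs ! 0 < n" "xs ! 1 < n" "xs ! 2 < n" by simp_all
    then show "maj_op n xs \<in> {0..<n}"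
      using maj_in[of "xs ! 0" "xs ! 1" "xs ! 2"] xs by (auto simp: maj_op_def)
  qed (simp add: maj_op_def)
  moreover have "preserves 3 (maj_op n) (star n - {r})" if r: "r \<in> set (star_list n)" for r
    unfolding preserves_def
  proof (intro allI impI)
    fix s :: "(nat \<times> nat) list" assume s: "length s = 3" "set s \<subseteq> star n - {r}"
    then obtain p1 p2 p3 where s_eq: "s = [p1, p2, p3]"
      by (auto simp: numeral_3_eq_3 length_Suc_conv)
    then have "map fst s \<in> tuples {0..<n} 3" "map snd s \<in> tuples {0..<n} 3"
      using s star_subset[of n] by (auto simp: tuples_def)
    moreover have "(maj (fst p1) (fst p2) (fst p3), maj (snd p1) (snd p2) (snd p3)) \<in> star n - {r}"
      using s s_eq r set_star_list[OF assms] by (intro maj_star) auto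
    ultimately show "(maj_op n (map fst s), maj_op n (map snd s)) \<in> star n - {r}"
      by (simp add: maj_op_def s_eq)
  qed
  ultimately show ?thesis by (auto simp: star_clone_def Pol_def all_operations_iff)
qed

lemma near_unanimity_maj_op: "near_unanimity {0..<n} 2 (maj_op n)"
  unfolding near_unanimity_def
proof (intro ballI allI impI)
  fix x y i :: nat assume "x \<in> {0..<n}" "y \<in> {0..<n}" "i < 2 + 1"
  moreover from this have "i = 0 \<or> i = 1 \<or> i = 2" by linarith
  ultimately show "maj_op n ((replicate (2 + 1) x)[i := y]) = x"
    by (elim disjE) (simp_all add: maj_op_def tuples_def numeral_3_eq_3 numeral_2_eq_2)
qed

lemma conservative_maj_op: "conservative {0..<n} 3 (maj_op n)"
  unfolding conservative_def
proof
  fix xs assume xs: "xs \<in> tuples {0..<n} 3"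
  then have "xs ! 0 \<in> set xs" "xs ! 1 \<in> set xs" "xs ! 2 \<in> set xs" by (auto simp: tuples_def)
  then show "maj_op n xs \<in> set xs"
    using maj_in[of "xs ! 0" "xs ! 1" "xs ! 2"] xs by (auto simp: maj_op_def)
qed

text \<open>
  Both tuples at which \<open>star_op n\<close> takes the value \<open>3\<close> have an entry \<open>3\<close>, and \<open>(3, 0)\<close>, \<open>(0, 3)\<close> are the only
  pairs of the star with an entry \<open>3\<close>. So a value \<open>(3, 0)\<close> or \<open>(0, 3)\<close> is always one of the arguments.
  The value \<open>(3, 3)\<close> would force the arguments to be the whole list \<open>star_list n\<close>, up to swapping
  coordinates, and the star is symmetric.
\<close>

lemma star_op_in_star_clone:
  assumes n: "n \<ge> 4"
  shows "(2 * n, star_op n) \<in> star_clone n"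
proof -
  let ?a = "map fst (star_list n)" and ?b = "map snd (star_list n)"
  have set_list: "set (star_list n) = star n - {(0, 0)}" using n by (intro set_star_list) simp
  have "star_op n \<in> tuples {0..<n} (2 * n) \<rightarrow>\<^sub>E {0..<n}"
    using n by (auto simp: star_op_def)
  moreover have "preserves (2 * n) (star_op n) (star n - {r})" if r: "r \<in> set (star_list n)" for r
    unfolding preserves_def
  proof (intro allI impI)
    fix s :: "(nat \<times> nat) list" assume s: "length s = 2 * n" "set s \<subseteq> star n - {r}"
    have tup: "map fst s \<in> tuples {0..<n} (2 * n)" "map snd s \<in> tuples {0..<n} (2 * n)"
      using s star_subset[of n] by (auto simp: tuples_def)
    have "(3, 0) \<in> set (star_list n)" "(0, 3) \<in> set (star_list n)"
      using n by (auto simp: set_list star_def)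
    then have three: "3 \<in> set ?a" "3 \<in> set ?b" by force+
    define P where "P xs \<longleftrightarrow> xs = ?a \<or> xs = ?b" for xs
    have fst3: "(3, 0) \<in> set s" if "P (map fst s)"
    proof -
      have "3 \<in> set (map fst s)" using that three unfolding P_def by metis
      then obtain y where "(3, y) \<in> set s" by auto
      moreover from this have "y = 0" using s by (auto simp: star_def)
      ultimately show ?thesis by simp
    qed
    have snd3: "(0, 3) \<in> set s" if "P (map snd s)"
    proof -
      have "3 \<in> set (map snd s)" using that three unfolding P_def by metis
      then obtain x where "(x, 3) \<in> set s" by auto
      moreover from this have "x = 0" using s by (auto simp: star_def)
      ultimately show ?thesis by simp
    qed
    have not_both: "\<not> (P (map fst s) \<and> P (map snd s))"
    proof
      assume both: "P (map fst s) \<and> P (map snd s)"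
      have "map fst s \<noteq> map snd s"
      proof
        assume eq: "map fst s = map snd s"
        have "\<forall>p\<in>set s. fst p = snd p" using eq by (simp add: map_eq_conv)
        then show False using fst3 both by fastforce
      qed
      then consider "map fst s = ?a" "map snd s = ?b" | "map fst s = ?b" "map snd s = ?a"
        using both unfolding P_def by metis
      then have "r \<in> set s"
      proof cases
        case 1
        then have "s = star_list n" by (metis zip_map_fst_snd)
        then show ?thesis using r by simp
      next
        case 2
        have "prod.swap r \<in> set (star_list n)"
          using r unfolding set_list star_def by auto
        then obtain i where i: "i < length (star_list n)" "star_list n ! i = prod.swap r"
          by (metis in_set_conv_nth)
        have len: "length s = length (star_list n)" using 2(1) by (metis length_map)
        have "fst (s ! i) = snd (star_list n ! i)" "snd (s ! i) = fst (star_list n ! i)"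
          using 2 i(1) len by (metis nth_map)+
        then have "s ! i = r" using i(2) by (simp add: prod_eq_iff)
        then show ?thesis using i(1) len nth_mem[of i s] by simp
      qed
      with s show False by auto
    qed
    have "(if P (map fst s) then 3 else 0, if P (map snd s) then 3 else 0) \<in> star n - {r}"
      using not_both fst3 snd3 s r n by (auto simp: set_list star_def)
    then show "(star_op n (map fst s), star_op n (map snd s)) \<in> star n - {r}"
      using tup by (simp add: star_op_def P_def)
  qed
  ultimately show ?thesis using n by (auto simp: star_clone_def Pol_def all_operations_iff)
qed

lemma star_op_not_preserves:
  assumes n: "n \<ge> 4"
  shows "\<not> preserves (2 * n) (star_op n) (star n)"
proof
  assume "preserves (2 * n) (star_op n) (star n)"
  moreover have "length (star_list n) = 2 * n" "set (star_list n) \<subseteq> star n"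
    using n length_star_list[of n] set_star_list[of n] by auto
  ultimately have "(star_op n (map fst (star_list n)), star_op n (map snd (star_list n))) \<in> star n"
    by (simp add: preserves_def)
  moreover have "map fst (star_list n) \<in> tuples {0..<n} (2 * n)"
      "map snd (star_list n) \<in> tuples {0..<n} (2 * n)"
    using \<open>length (star_list n) = 2 * n\<close> \<open>set (star_list n) \<subseteq> star n\<close> star_subset[of n]
    by (auto simp: tuples_def)
  ultimately show False by (simp add: star_op_def star_def)
qed

lemma low_arity_preserves_star:
  assumes n: "n \<ge> 4" and k: "k < 2 * n" and f: "(k, f) \<in> star_clone n"
  shows "preserves k f (star n)"
  unfolding preserves_def
proof (intro allI impI)
  fix s :: "(nat \<times> nat) list" assume s: "length s = k" "set s \<subseteq> star n"
  have "distinct (star_list n)"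
    by (auto simp: star_list_def distinct_map inj_on_def)
  then have "card (set (star_list n)) = 2 * n"
    using n distinct_card[of "star_list n"] length_star_list[of n] by simp
  moreover have "card (set s) < 2 * n" using card_length[of s] s k by simp
  ultimately have "\<not> set (star_list n) \<subseteq> set s" by (metis card_mono finite_set not_less)
  then obtain r where r: "r \<in> set (star_list n)" "r \<notin> set s" by auto
  then have "preserves k f (star n - {r})" using f by (auto simp: star_clone_def Pol_def)
  moreover have "set s \<subseteq> star n - {r}" using s r by auto
  ultimately show "(f (map fst s), f (map snd s)) \<in> star n"
    using s by (auto simp: preserves_def)
qed

theorem theorem3p2:
  fixes n :: nat
  assumes "n \<ge> 4"
  shows "gamma 2 n \<ge> 2 * n"
proof -
  let ?A = "{0..<n}" and ?C = "star_clone n"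
  have maj: "(3, maj_op n) \<in> ?C" using assms by (intro maj_op_in_star_clone) simp
  have "?C = Clo ?A (arity_part ?C (card (?A \<times> ?A) + 3))"
    by (rule majority_clone_generated[OF is_clone_star_clone maj near_unanimity_maj_op]) simp
  then have ex: "\<exists>m. m \<ge> 1 \<and> ?C = Clo ?A (arity_part ?C m)" by (metis le_add2 one_le_numeral order_trans)
  have "2 * n \<le> m" if m: "?C = Clo ?A (arity_part ?C m)" for m
  proof (rule ccontr)
    assume "\<not> 2 * n \<le> m"
    then have "arity_part ?C m \<subseteq> Pol ?A {star n}"
      using low_arity_preserves_star[OF assms] is_clone_subset[OF is_clone_star_clone]
      by (force simp: arity_part_def Pol_def)
    then have "Clo ?A (arity_part ?C m) \<subseteq> Pol ?A {star n}"
      using star_subset by (intro Clo_least is_clone_Pol) auto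
    then have "(2 * n, star_op n) \<in> Pol ?A {star n}"
      using m star_op_in_star_clone[OF assms] by auto
    then show False using star_op_not_preserves[OF assms] by (simp add: Pol_def)
  qed
  then have "2 * n \<le> generation_arity ?A ?C"
    unfolding generation_arity_def using LeastI_ex[OF ex] by blast
  also have "generation_arity ?A ?C \<le> gamma 2 n"
    unfolding gamma_def
  proof (rule Max_ge)
    have "conservative_nu_clones 2 n \<subseteq> {C. is_clone ?A C \<and> (\<exists>g. (3, g) \<in> C \<and> near_unanimity ?A 2 g)}"
      by (auto simp: conservative_nu_clones_def)
    then have "finite (conservative_nu_clones 2 n)"
      using finite_majority_clones[of ?A] finite_subset by blast
    then show "finite {generation_arity ?A C | C. C \<in> conservative_nu_clones 2 n}" by simp
    show "generation_arity ?A ?C \<in> {generation_arity ?A C | C. C \<in> conservative_nu_clones 2 n}"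
    proof -
      have "?C \<in> conservative_nu_clones 2 n"
        using maj is_clone_star_clone near_unanimity_maj_op conservative_maj_op
        by (auto simp: conservative_nu_clones_def)
      then show ?thesis by blast
    qed
  qed
  finally show ?thesis .
qed

end
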